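(* Let $(A_b,A_w)$ be a pairwise comparison system on $C=\{1,\dots,n\}$ with best criterion $b$ and worst criterion $w$, let $D=C\setminus\{b,w\}$, let $D_1,D_2,\epsilon_i,\epsilon_{i,j}$ be as defined in the context, and let $\eta^*$ be the optimal objective value of the problem $$\min\ \eta\quad\text{s.t.}\quad |\tilde a_{bi}-a_{bi}|\le\eta,\ |\tilde a_{iw}-a_{iw}|\le\eta,\ |\tilde a_{bw}-a_{bw}|\le\eta,\ \tilde a_{bi}\tilde a_{iw}=\tilde a_{bw},\ \tilde a_{bi},\tilde a_{iw},\tilde a_{bw}\ge 0\ \text{ for all } i\in D .$$ For a real number $P$ and $i\in D$ put $$\alpha_i(P)=\frac{a_{bi}-a_{iw}+\sqrt{(a_{bi}+a_{iw})^2-4a_{bi}a_{iw}+4P}}{2},\qquad \beta_i(P)=\frac{-a_{bi}+a_{iw}+\sqrt{(a_{bi}+a_{iw})^2-4a_{bi}a_{iw}+4P}}{2}.$$ Then the following hold. 1. If $\epsilon_{i_0}=\max\{\epsilon_i,\epsilon_{i,j}:i,j\in D\}$ for some $i_0\in D_1$, then $\eta^*=\epsilon_{i_0}$. Also, $(\tilde A_b,\tilde A_w)$ defined by $\tilde a_{bw}=a_{bw}-\epsilon_{i_0}$, $\tilde a_{bi}=\alpha_i(a_{bw}-\epsilon_{i_0})$, $\tilde a_{iw}=\beta_i(a_{bw}-\epsilon_{i_0})$ for all $i\in D$ is an optimally modified PCS. 2. If $\epsilon_{j_0}=\max\{\epsilon_i,\epsilon_{i,j}:i,j\in D\}$ for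 some $j_0\in D_2$, then $\eta^*=\epsilon_{j_0}$. Also, $(\tilde A_b,\tilde A_w)$ defined by $\tilde a_{bw}=a_{bw}+\epsilon_{j_0}$, $\tilde a_{bi}=\alpha_i(a_{bw}+\epsilon_{j_0})$, $\tilde a_{iw}=\beta_i(a_{bw}+\epsilon_{j_0})$ for all $i\in D$ is an optimally modified PCS. 3. If $\epsilon_{i_0,j_0}=\max\{\epsilon_i,\epsilon_{i,j}:i,j\in D\}$ for some $i_0,j_0\in D$, then $\eta^*=\epsilon_{i_0,j_0}$. Also, with $P=(a_{bi_0}+\epsilon_{i_0,j_0})(a_{i_0w}+\epsilon_{i_0,j_0})$, the pair $(\tilde A_b,\tilde A_w)$ defined by $\tilde a_{bw}=P$, $\tilde a_{bi}=\alpha_i(P)$, $\tilde a_{iw}=\beta_i(P)$ for all $i\in D$ is an optimally modified PCS.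
   Context: Let $n\ge 3$, $C=\{1,\dots,n\}$ the set of criteria, $b\ne w$ in $C$ the best and worst criterion, $D=C\setminus\{b,w\}$. A pairwise comparison system (PCS) is a pair $(A_b,A_w)$ with $A_b=(a_{b1},\dots,a_{bn})$ and $A_w=(a_{1w},\dots,a_{nw})^T$ of real numbers, where $a_{ij}$ is the relative preference of criterion $i$ over criterion $j$, with $a_{bb}=a_{ww}=1$ and $1\le a_{bi},a_{iw}\le a_{bw}$ for all $i\in D$ (so $a_{bw}\geq 1$). $D_1=\{i\in D:a_{bi}a_{iw}<a_{bw}\}$, $D_2=\{i\in D:a_{bi}a_{iw}>a_{bw}\}$, and for $i,j\in D$ $$\epsilon_i=\left|\frac{a_{bi}+a_{iw}+1-\sqrt{(a_{bi}+a_{iw}+1)^2-4(a_{bi}a_{iw}-a_{bw})}}{2}\right|,\qquad \epsilon_{i,j}=\left|\frac{a_{bi}a_{iw}-a_{bj}a_{jw}}{a_{bi}+a_{iw}+a_{bj}+a_{jw}}\right|.$$ An optimally modified PCS is a pair $(\tilde A_b,\tilde A_w)$ whose entries $\tilde a_{bi},\tilde a_{iw}$ ($i\in D$) and $\tilde a_{bw}$ form, together with $\eta=\eta^*$, an optimal solution of the minimization problem in the claim, completed by $\tilde a_{bb}=\tilde a_{ww}=1$.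
   Formalization: In part 3 the formula for the modified PCS is asserted only when a_{bi0}a_{i0w} ≤ a_{bj0}a_{j0w}; with the strict opposite order the stated pair is always infeasible (e.g. a_bw=4, (3,3), (1,1)). The value η*=ε_{i0,j0} is proved for all i0, j0. *)

theory Defs
  imports Complex_Main
begin

text \<open>
  A pairwise comparison system on the criteria \<open>{1..n}\<close> is given by two functions
  \<open>Ab\<close>, \<open>Aw\<close> with \<open>Ab i\<close> the relative preference of the best criterion \<open>b\<close> over \<open>i\<close> and
  \<open>Aw i\<close> that of \<open>i\<close> over the worst criterion \<open>w\<close>. Only the values on \<open>{1..n}\<close> matter.
  The preference of \<open>b\<close> over \<open>w\<close> is an entry of both vectors: \<open>Ab w = Aw b\<close>.
\<close>

definition other_criteria :: "nat \<Rightarrow> nat \<Rightarrow> nat \<Rightarrow> nat set" where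
  "other_criteria n b w = {1..n} - {b, w}"

definition is_pcs :: "nat \<Rightarrow> nat \<Rightarrow> nat \<Rightarrow> (nat \<Rightarrow> real) \<Rightarrow> (nat \<Rightarrow> real) \<Rightarrow> bool" where
  "is_pcs n b w Ab Aw \<longleftrightarrow>
     Ab b = 1 \<and> Aw w = 1 \<and> Ab w = Aw b \<and>
     (\<forall>i\<in>other_criteria n b w. 1 \<le> Ab i \<and> Ab i \<le> Ab w \<and> 1 \<le> Aw i \<and> Aw i \<le> Ab w)"

definition D1 :: "nat \<Rightarrow> nat \<Rightarrow> nat \<Rightarrow> (nat \<Rightarrow> real) \<Rightarrow> (nat \<Rightarrow> real) \<Rightarrow> nat set" where
  "D1 n b w Ab Aw = {i \<in> other_criteria n b w. Ab i * Aw i < Ab w}"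

definition D2 :: "nat \<Rightarrow> nat \<Rightarrow> nat \<Rightarrow> (nat \<Rightarrow> real) \<Rightarrow> (nat \<Rightarrow> real) \<Rightarrow> nat set" where
  "D2 n b w Ab Aw = {i \<in> other_criteria n b w. Ab i * Aw i > Ab w}"

definition eps1 :: "nat \<Rightarrow> (nat \<Rightarrow> real) \<Rightarrow> (nat \<Rightarrow> real) \<Rightarrow> nat \<Rightarrow> real" where
  "eps1 w Ab Aw i =
     \<bar>(Ab i + Aw i + 1 - sqrt ((Ab i + Aw i + 1)\<^sup>2 - 4 * (Ab i * Aw i - Ab w))) / 2\<bar>"

definition eps2 :: "(nat \<Rightarrow> real) \<Rightarrow> (nat \<Rightarrow> real) \<Rightarrow> nat \<Rightarrow> nat \<Rightarrow> real" where
  "eps2 Ab Aw i j = \<bar>(Ab i * Aw i - Ab j * Aw j) / (Ab i + Aw i + Ab j + Aw j)\<bar>"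

definition max_eps :: "nat \<Rightarrow> nat \<Rightarrow> nat \<Rightarrow> (nat \<Rightarrow> real) \<Rightarrow> (nat \<Rightarrow> real) \<Rightarrow> real" where
  "max_eps n b w Ab Aw =
     Max ({eps1 w Ab Aw i | i. i \<in> other_criteria n b w} \<union>
          {eps2 Ab Aw i j | i j. i \<in> other_criteria n b w \<and> j \<in> other_criteria n b w})"

text \<open>
  The optimization problem has the decision variables \<open>x i\<close>, \<open>y i\<close> (for \<open>i\<close> other than
  \<open>b\<close>, \<open>w\<close>), \<open>z\<close> and \<open>\<eta>\<close>: the modified preferences of \<open>b\<close> over \<open>i\<close>, of \<open>i\<close> over \<open>w\<close>
  and of \<open>b\<close> over \<open>w\<close>, and the objective.
\<close>

definition feasible ::
  "nat \<Rightarrow> nat \<Rightarrow> nat \<Rightarrow> (nat \<Rightarrow> real) \<Rightarrow> (nat \<Rightarrow> real) \<Rightarrow>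
   (nat \<Rightarrow> real) \<Rightarrow> (nat \<Rightarrow> real) \<Rightarrow> real \<Rightarrow> real \<Rightarrow> bool" where
  "feasible n b w Ab Aw x y z \<eta> \<longleftrightarrow>
     (\<forall>i\<in>other_criteria n b w.
        \<bar>x i - Ab i\<bar> \<le> \<eta> \<and> \<bar>y i - Aw i\<bar> \<le> \<eta> \<and> x i * y i = z \<and> 0 \<le> x i \<and> 0 \<le> y i) \<and>
     \<bar>z - Ab w\<bar> \<le> \<eta> \<and> 0 \<le> z"

definition optimal_solution ::
  "nat \<Rightarrow> nat \<Rightarrow> nat \<Rightarrow> (nat \<Rightarrow> real) \<Rightarrow> (nat \<Rightarrow> real) \<Rightarrow>
   (nat \<Rightarrow> real) \<Rightarrow> (nat \<Rightarrow> real) \<Rightarrow> real \<Rightarrow> real \<Rightarrow> bool" where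
  "optimal_solution n b w Ab Aw x y z \<eta> \<longleftrightarrow>
     feasible n b w Ab Aw x y z \<eta> \<and>
     (\<forall>x' y' z' \<eta>'. feasible n b w Ab Aw x' y' z' \<eta>' \<longrightarrow> \<eta> \<le> \<eta>')"

definition optimal_value ::
  "nat \<Rightarrow> nat \<Rightarrow> nat \<Rightarrow> (nat \<Rightarrow> real) \<Rightarrow> (nat \<Rightarrow> real) \<Rightarrow> real" where
  "optimal_value n b w Ab Aw = Inf {\<eta>. \<exists>x y z. feasible n b w Ab Aw x y z \<eta>}"

text \<open>
  The bounds of \<^const>\<open>is_pcs\<close> relative to the modified preference of \<open>b\<close> over \<open>w\<close>
  are deliberately not required of a modified system.
\<close>

definition optimally_modified_pcs ::
  "nat \<Rightarrow> nat \<Rightarrow> nat \<Rightarrow> (nat \<Rightarrow> real) \<Rightarrow> (nat \<Rightarrow> real) \<Rightarrow>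
   (nat \<Rightarrow> real) \<Rightarrow> (nat \<Rightarrow> real) \<Rightarrow> bool" where
  "optimally_modified_pcs n b w Ab Aw Tb Tw \<longleftrightarrow>
     Tb b = 1 \<and> Tw w = 1 \<and> Tb w = Tw b \<and>
     optimal_solution n b w Ab Aw Tb Tw (Tb w) (optimal_value n b w Ab Aw)"

definition alpha :: "(nat \<Rightarrow> real) \<Rightarrow> (nat \<Rightarrow> real) \<Rightarrow> nat \<Rightarrow> real \<Rightarrow> real" where
  "alpha Ab Aw i P =
     (Ab i - Aw i + sqrt ((Ab i + Aw i)\<^sup>2 - 4 * Ab i * Aw i + 4 * P)) / 2"

definition beta :: "(nat \<Rightarrow> real) \<Rightarrow> (nat \<Rightarrow> real) \<Rightarrow> nat \<Rightarrow> real \<Rightarrow> real" where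
  "beta Ab Aw i P =
     (- Ab i + Aw i + sqrt ((Ab i + Aw i)\<^sup>2 - 4 * Ab i * Aw i + 4 * P)) / 2"

definition modified_best ::
  "nat \<Rightarrow> nat \<Rightarrow> (nat \<Rightarrow> real) \<Rightarrow> (nat \<Rightarrow> real) \<Rightarrow> real \<Rightarrow> nat \<Rightarrow> real" where
  "modified_best b w Ab Aw P i =
     (if i = b then 1 else if i = w then P else alpha Ab Aw i P)"

definition modified_worst ::
  "nat \<Rightarrow> nat \<Rightarrow> (nat \<Rightarrow> real) \<Rightarrow> (nat \<Rightarrow> real) \<Rightarrow> real \<Rightarrow> nat \<Rightarrow> real" where
  "modified_worst b w Ab Aw P i =
     (if i = w then 1 else if i = b then P else beta Ab Aw i P)"

end

theory Submission
  imports Defs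
begin

text \<open>
  Fix a tolerance \<open>E\<close>. The products \<open>x * y\<close> of nonnegative reals with
  \<open>\<bar>x - Ab i\<bar> \<le> E\<close> and \<open>\<bar>y - Aw i\<bar> \<le> E\<close> form the interval from
  \<open>max 0 (Ab i - E) * max 0 (Aw i - E)\<close> to \<open>(Ab i + E) * (Aw i + E)\<close>, and the admissible
  values of the modified preference of \<open>b\<close> over \<open>w\<close> form the interval from \<open>Ab w - E\<close> to
  \<open>Ab w + E\<close> (intersected with the nonnegative reals). The optimization problem asks for the
  smallest \<open>E\<close> for which all these intervals have a common point.

  The numbers \<open>\<epsilon>\<^sub>i\<close> and \<open>\<epsilon>\<^sub>i\<^sub>,\<^sub>j\<close> are the answers for two intervals:
  \<open>\<epsilon>\<^sub>i\<close> is the least \<open>E\<close> at which the interval of \<open>i\<close> meets that around \<open>Ab w\<close>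
  (\<open>eps1_le_iff\<close>), and \<open>\<epsilon>\<^sub>i\<^sub>,\<^sub>j\<close> the least \<open>E\<close> at which the intervals of \<open>i\<close> and \<open>j\<close> meet
  (\<open>eps2_le_iff\<close>). Hence every feasible \<open>\<eta>\<close> is at least their maximum.

  Conversely, intervals on a line that meet pairwise have a common point. At the maximal value
  \<open>E\<close> this point is explicit: the two intervals responsible for the maximum only touch, so the
  upper end of one is the lower end of the other. That end \<open>P\<close> lies in every further interval,
  since the latter meets both of the touching ones. The three parts of the theorem are the
  three choices of the touching intervals: \<open>i\<close> below \<open>Ab w\<close>, \<open>i\<close> above \<open>Ab w\<close>, and \<open>i\<close> below \<open>j\<close>
  (\<open>eps1_touch_below\<close>, \<open>eps1_touch_above\<close>, \<open>eps2_touch\<close>).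

  Finally, \<open>\<alpha>\<^sub>i(P)\<close> and \<open>\<beta>\<^sub>i(P)\<close> factor \<open>P\<close> by shifting \<open>Ab i\<close> and \<open>Aw i\<close> by one common
  amount, which has absolute value at most \<open>E\<close> as soon as \<open>P\<close> lies in the interval of \<open>i\<close>
  (\<open>alpha_beta_within\<close>).
\<close>

section \<open>Products attainable within a tolerance\<close>

text \<open>
  The factors are cut off at zero because the modified preferences have to be nonnegative; without
  this, two negative factors would give a wrong positive lower bound when \<open>E\<close> exceeds both
  \<open>p\<close> and \<open>q\<close>.
\<close>

definition least_product :: "real \<Rightarrow> real \<Rightarrow> real \<Rightarrow> real" where
  "least_product p q E = max 0 (p - E) * max 0 (q - E)"

lemma least_product_nonneg: "0 \<le> least_product p q E"
  by (simp add: least_product_def)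

lemma least_product_eq:
  "E \<le> p \<Longrightarrow> E \<le> q \<Longrightarrow> least_product p q E = (p - E) * (q - E)"
  by (simp add: least_product_def)

lemma least_product_eq_0: "p \<le> E \<or> q \<le> E \<Longrightarrow> least_product p q E = 0"
  by (auto simp: least_product_def)

lemma product_bounds:
  fixes x y p q E :: real
  assumes "0 \<le> x" "0 \<le> y" "\<bar>x - p\<bar> \<le> E" "\<bar>y - q\<bar> \<le> E"
  shows "least_product p q E \<le> x * y" and "x * y \<le> (p + E) * (q + E)"
proof -
  show "least_product p q E \<le> x * y"
    unfolding least_product_def using assms by (intro mult_mono) auto
  show "x * y \<le> (p + E) * (q + E)"
    using assms by (intro mult_mono) auto
qed

text \<open>
  With \<open>u = alpha Ab Aw i P - Ab i = beta Ab Aw i P - Aw i\<close>, the number \<open>u\<close> is the larger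
  solution of \<open>(Ab i + u) * (Aw i + u) = P\<close>. On the range where both factors are nonnegative the
  left-hand side increases in \<open>u\<close>, so bounds on \<open>P\<close> turn into bounds on \<open>u\<close>.
\<close>

lemma alpha_beta_within:
  assumes pq: "0 \<le> Ab i" "0 \<le> Aw i" and E: "0 \<le> E"
    and lo: "least_product (Ab i) (Aw i) E \<le> P" and hi: "P \<le> (Ab i + E) * (Aw i + E)"
  shows "\<bar>alpha Ab Aw i P - Ab i\<bar> \<le> E" "\<bar>beta Ab Aw i P - Aw i\<bar> \<le> E"
    and "alpha Ab Aw i P * beta Ab Aw i P = P"
    and "0 \<le> alpha Ab Aw i P" "0 \<le> beta Ab Aw i P"
proof -
  define p q where "p = Ab i" and "q = Aw i"
  define r where "r = sqrt ((p + q)\<^sup>2 - 4 * p * q + 4 * P)"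
  have disc: "(p + q)\<^sup>2 - 4 * p * q + 4 * P = (p - q)\<^sup>2 + 4 * P"
    by (simp add: power2_eq_square algebra_simps)
  have P: "0 \<le> P"
    using lo least_product_nonneg[of "Ab i" "Aw i" E] by linarith
  have r2: "r\<^sup>2 = (p - q)\<^sup>2 + 4 * P"
    unfolding r_def disc using P by simp
  have r_abs: "\<bar>p - q\<bar> \<le> r"
    unfolding r_def disc using P by (intro real_le_rsqrt) simp
  have "r \<le> p + q + 2 * E"
  proof (rule power2_le_imp_le)
    show "r\<^sup>2 \<le> (p + q + 2 * E)\<^sup>2"
      using hi unfolding r2 p_def[symmetric] q_def[symmetric]
      by (simp add: power2_eq_square algebra_simps)
    show "0 \<le> p + q + 2 * E"
      using pq E by (simp add: p_def q_def)
  qed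
  moreover have "p + q - 2 * E \<le> r"
  proof (cases "E \<le> p \<and> E \<le> q")
    case True
    then have "(p - E) * (q - E) \<le> P"
      using lo by (simp add: least_product_eq p_def q_def)
    then have "(p + q - 2 * E)\<^sup>2 \<le> r\<^sup>2"
      unfolding r2 by (simp add: power2_eq_square algebra_simps)
    then show ?thesis
      using r_abs by (auto intro: power2_le_imp_le)
  next
    case False
    then show ?thesis
      using r_abs by linarith
  qed
  ultimately have r: "r \<le> p + q + 2 * E" "p + q - 2 * E \<le> r" .
  have a: "alpha Ab Aw i P = (p - q + r) / 2" and b: "beta Ab Aw i P = (- p + q + r) / 2"
    by (simp_all add: alpha_def beta_def r_def p_def q_def)
  show "\<bar>alpha Ab Aw i P - Ab i\<bar> \<le> E"
    unfolding a p_def[symmetric] using r by (simp add: abs_le_iff field_simps)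
  show "\<bar>beta Ab Aw i P - Aw i\<bar> \<le> E"
    unfolding b q_def[symmetric] using r by (simp add: abs_le_iff field_simps)
  show "alpha Ab Aw i P * beta Ab Aw i P = P"
    using r2 unfolding a b by (simp add: power2_eq_square algebra_simps)
  show "0 \<le> alpha Ab Aw i P" "0 \<le> beta Ab Aw i P"
    unfolding a b using r_abs by auto
qed


section \<open>Two intervals meet\<close>

text \<open>
  The number under the root is the discriminant of \<open>(p + t) * (q + t) = c - t\<close>, and also of
  \<open>(p - t) * (q - t) = c + t\<close>. Nonnegativity of \<open>p\<close>, \<open>q\<close> and \<open>c\<close> forces the smaller root of the
  latter equation to be at most \<open>p\<close> and \<open>q\<close>; this is the bound \<open>root_ge\<close>.
\<close>

lemma root_ge:
  fixes p q c :: real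
  assumes "0 \<le> p" "0 \<le> q" "0 \<le> c"
  shows "\<bar>p - q\<bar> + 1 \<le> sqrt ((p + q + 1)\<^sup>2 - 4 * (p * q - c))"
proof (rule real_le_rsqrt)
  have "(p + q + 1)\<^sup>2 - 4 * (p * q - c) - (\<bar>p - q\<bar> + 1)\<^sup>2 = 2 * (p + q - \<bar>p - q\<bar>) + 4 * c"
    by (simp add: power2_eq_square algebra_simps abs_if)
  moreover have "\<bar>p - q\<bar> \<le> p + q"
    using assms by linarith
  ultimately have "0 \<le> (p + q + 1)\<^sup>2 - 4 * (p * q - c) - (\<bar>p - q\<bar> + 1)\<^sup>2"
    using assms by simp
  then show "(\<bar>p - q\<bar> + 1)\<^sup>2 \<le> (p + q + 1)\<^sup>2 - 4 * (p * q - c)"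
    by (simp only: diff_ge_0_iff_ge)
qed

lemma root_square:
  fixes p q c :: real
  assumes "0 \<le> p" "0 \<le> q" "0 \<le> c"
  shows "(sqrt ((p + q + 1)\<^sup>2 - 4 * (p * q - c)))\<^sup>2 = (p + q + 1)\<^sup>2 - 4 * (p * q - c)"
proof -
  have "0 \<le> sqrt ((p + q + 1)\<^sup>2 - 4 * (p * q - c))"
    using root_ge[OF assms] by linarith
  then show ?thesis
    by simp
qed

text \<open>
  Each of the two conditions on the right is a quadratic inequality in \<open>E\<close>. Completing the square
  bounds the root of the common discriminant from above and from below, and these are the two bounds
  hidden in the absolute value of \<open>eps1\<close>. If \<open>E\<close> exceeds \<open>p\<close> or \<open>q\<close>, the second condition and
  the corresponding bound hold together, the latter by \<open>root_ge\<close>.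
\<close>

lemma eps1_le_iff:
  assumes pq: "0 \<le> Ab i" "0 \<le> Aw i" and c: "0 \<le> Ab w" and E: "0 \<le> E"
  shows "eps1 w Ab Aw i \<le> E \<longleftrightarrow>
    Ab w - E \<le> (Ab i + E) * (Aw i + E) \<and> least_product (Ab i) (Aw i) E \<le> Ab w + E"
proof -
  define p q where "p = Ab i" and "q = Aw i"
  define r where "r = sqrt ((p + q + 1)\<^sup>2 - 4 * (p * q - Ab w))"
  have nn: "0 \<le> p" "0 \<le> q"
    using pq by (simp_all add: p_def q_def)
  have r_abs: "\<bar>p - q\<bar> + 1 \<le> r"
    unfolding r_def by (rule root_ge[OF nn c])
  have r2: "r\<^sup>2 = (p + q + 1)\<^sup>2 - 4 * (p * q - Ab w)"
    unfolding r_def by (rule root_square[OF nn c])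
  have r0: "0 \<le> r"
    using r_abs by linarith
  have "eps1 w Ab Aw i \<le> E \<longleftrightarrow> r \<le> p + q + 1 + 2 * E \<and> p + q + 1 - 2 * E \<le> r"
    unfolding eps1_def p_def[symmetric] q_def[symmetric] r_def[symmetric]
    by (auto simp: abs_le_iff field_simps)
  moreover have "r \<le> p + q + 1 + 2 * E \<longleftrightarrow> Ab w - E \<le> (p + E) * (q + E)"
  proof -
    have "r \<le> p + q + 1 + 2 * E \<longleftrightarrow> r\<^sup>2 \<le> (p + q + 1 + 2 * E)\<^sup>2"
      using r0 nn E by (intro power_mono_iff[symmetric]) auto
    also have "\<dots> \<longleftrightarrow> Ab w - E \<le> (p + E) * (q + E)"
      unfolding r2 by (auto simp: power2_eq_square algebra_simps)
    finally show ?thesis .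
  qed
  moreover have "p + q + 1 - 2 * E \<le> r \<longleftrightarrow> least_product p q E \<le> Ab w + E"
  proof (cases "E \<le> p \<and> E \<le> q")
    case True
    then have "p + q + 1 - 2 * E \<le> r \<longleftrightarrow> (p + q + 1 - 2 * E)\<^sup>2 \<le> r\<^sup>2"
      using r0 by (intro power_mono_iff[symmetric]) auto
    also have "\<dots> \<longleftrightarrow> (p - E) * (q - E) \<le> Ab w + E"
      unfolding r2 by (auto simp: power2_eq_square algebra_simps)
    finally show ?thesis
      using True by (simp add: least_product_eq)
  next
    case False
    then have "p + q + 1 - 2 * E \<le> r"
      using r_abs by linarith
    moreover have "least_product p q E = 0"
      using False by (intro least_product_eq_0) auto
    ultimately show ?thesis
      using c E by simp
  qed
  ultimately show ?thesis
    by (simp add: p_def q_def)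
qed

text \<open>
  The quadratic terms of the two ends agree, so the comparison of the ends is linear in \<open>E\<close>.
  If the lower end has been cut off at zero, both sides hold.
\<close>

lemma least_product_le_iff:
  fixes p q p' q' E :: real
  assumes "0 \<le> p" "0 \<le> q" "0 \<le> p'" "0 \<le> q'" "0 \<le> E"
  shows "least_product p q E \<le> (p' + E) * (q' + E) \<longleftrightarrow>
    p * q - p' * q' \<le> E * (p + q + p' + q')"
proof (cases "E \<le> p \<and> E \<le> q")
  case True
  then show ?thesis
    by (auto simp: least_product_eq algebra_simps)
next
  case False
  then have "p * q \<le> E * q \<or> p * q \<le> E * p"
    using assms by (metis le_cases mult.commute mult_right_mono)
  moreover have "0 \<le> E * p" "0 \<le> E * q" "0 \<le> E * p'" "0 \<le> E * q'" "0 \<le> p' * q'"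
    using assms by simp_all
  moreover have "E * (p + q + p' + q') = E * p + E * q + E * p' + E * q'"
    by (simp add: algebra_simps)
  ultimately have "p * q - p' * q' \<le> E * (p + q + p' + q')"
    by linarith
  moreover have "least_product p q E = 0"
    using False by (intro least_product_eq_0) auto
  ultimately show ?thesis
    using assms by simp
qed

lemma eps2_le_iff:
  assumes "0 < Ab i" "0 < Aw i" "0 < Ab j" "0 < Aw j" "0 \<le> E"
  shows "eps2 Ab Aw i j \<le> E \<longleftrightarrow>
    least_product (Ab i) (Aw i) E \<le> (Ab j + E) * (Aw j + E) \<and>
    least_product (Ab j) (Aw j) E \<le> (Ab i + E) * (Aw i + E)"
proof -
  define S where "S = Ab i + Aw i + Ab j + Aw j"
  have S: "0 < S"
    using assms by (simp add: S_def)
  have "eps2 Ab Aw i j \<le> E \<longleftrightarrow> \<bar>Ab i * Aw i - Ab j * Aw j\<bar> \<le> E * S"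
    using S unfolding eps2_def S_def[symmetric] by (simp add: abs_divide pos_divide_le_eq)
  also have "\<dots> \<longleftrightarrow> Ab i * Aw i - Ab j * Aw j \<le> E * S \<and> Ab j * Aw j - Ab i * Aw i \<le> E * S"
    by auto
  finally show ?thesis
    using assms least_product_le_iff[of "Ab i" "Aw i" "Ab j" "Aw j" E]
      least_product_le_iff[of "Ab j" "Aw j" "Ab i" "Aw i" E]
    by (simp add: S_def add_ac)
qed


section \<open>Two intervals touch\<close>

text \<open>
  The absolute values in \<open>eps1\<close> and \<open>eps2\<close> are resolved by the order of the products, and what
  remains solves the equation between the facing ends of the two intervals. Where the end is a
  \<open>least_product\<close>, the solution must also be at most each of the two preferences, so that no
  factor is cut off.
\<close>

lemma eps1_touch_below:
  assumes pq: "0 \<le> Ab i" "0 \<le> Aw i" and c: "0 \<le> Ab w" and less: "Ab i * Aw i < Ab w"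
  shows "(Ab i + eps1 w Ab Aw i) * (Aw i + eps1 w Ab Aw i) = Ab w - eps1 w Ab Aw i"
proof -
  define p q t where "p = Ab i" and "q = Aw i" and "t = eps1 w Ab Aw i"
  define r where "r = sqrt ((p + q + 1)\<^sup>2 - 4 * (p * q - Ab w))"
  have t: "t = \<bar>(p + q + 1 - r) / 2\<bar>"
    unfolding t_def eps1_def r_def p_def q_def ..
  have "p + q + 1 \<le> r"
    unfolding r_def using less by (intro real_le_rsqrt) (simp add: p_def q_def)
  then have "r = 2 * t + (p + q + 1)"
    unfolding t by (simp add: abs_if field_simps)
  moreover have "r\<^sup>2 = (p + q + 1)\<^sup>2 - 4 * (p * q - Ab w)"
    unfolding r_def using pq c by (intro root_square) (simp_all add: p_def q_def)
  ultimately have "(p + t) * (q + t) = Ab w - t"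
    by (simp add: power2_eq_square algebra_simps)
  then show ?thesis
    by (simp add: p_def q_def t_def)
qed

lemma eps1_touch_above:
  assumes pq: "0 \<le> Ab i" "0 \<le> Aw i" and c: "0 \<le> Ab w" and less: "Ab w < Ab i * Aw i"
  shows "least_product (Ab i) (Aw i) (eps1 w Ab Aw i) = Ab w + eps1 w Ab Aw i"
proof -
  define p q t where "p = Ab i" and "q = Aw i" and "t = eps1 w Ab Aw i"
  define r where "r = sqrt ((p + q + 1)\<^sup>2 - 4 * (p * q - Ab w))"
  have nn: "0 \<le> p" "0 \<le> q"
    using pq by (simp_all add: p_def q_def)
  have t: "t = \<bar>(p + q + 1 - r) / 2\<bar>"
    unfolding t_def eps1_def r_def p_def q_def ..
  have "r \<le> p + q + 1"
    unfolding r_def using less nn by (intro real_le_lsqrt) (simp_all add: p_def q_def)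
  then have r: "r = (p + q + 1) - 2 * t"
    unfolding t by (simp add: abs_if field_simps)
  have r2: "r\<^sup>2 = (p + q + 1)\<^sup>2 - 4 * (p * q - Ab w)"
    unfolding r_def by (rule root_square[OF nn c])
  have "(p - t) * (q - t) = Ab w + t"
    using r2 unfolding r by (simp add: power2_eq_square algebra_simps)
  moreover have "\<bar>p - q\<bar> + 1 \<le> r"
    unfolding r_def by (rule root_ge[OF nn c])
  then have "t \<le> p" "t \<le> q"
    using r by linarith+
  ultimately show ?thesis
    by (simp add: least_product_eq p_def q_def t_def)
qed

lemma eps2_touch:
  assumes pos: "0 < Ab i" "0 < Aw i" "0 < Ab j" "0 < Aw j" and le: "Ab i * Aw i \<le> Ab j * Aw j"
  shows "(Ab i + eps2 Ab Aw i j) * (Aw i + eps2 Ab Aw i j) =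
    least_product (Ab j) (Aw j) (eps2 Ab Aw i j)"
proof -
  define t S where "t = eps2 Ab Aw i j" and "S = Ab i + Aw i + Ab j + Aw j"
  have S: "0 < S"
    using pos by (simp add: S_def)
  have "t = (Ab j * Aw j - Ab i * Aw i) / S"
    using S le unfolding t_def eps2_def S_def[symmetric] by (simp add: abs_divide)
  then have tS: "t * S = Ab j * Aw j - Ab i * Aw i"
    using S by simp
  have "0 < Ab i * Aw i"
    using pos by simp
  moreover have "Ab j * Aw j \<le> Ab j * S" "Ab j * Aw j \<le> Aw j * S"
    using pos by (simp_all add: S_def algebra_simps)
  ultimately have "t * S \<le> Ab j * S" "t * S \<le> Aw j * S"
    unfolding tS by linarith+
  then have "t \<le> Ab j" "t \<le> Aw j"
    using S by simp_all
  then show ?thesis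
    using tS unfolding t_def[symmetric] S_def by (simp add: least_product_eq algebra_simps)
qed


section \<open>The maximum and the optimal value\<close>

lemma finite_eps:
  "finite ({eps1 w Ab Aw i | i. i \<in> other_criteria n b w} \<union>
    {eps2 Ab Aw i j | i j. i \<in> other_criteria n b w \<and> j \<in> other_criteria n b w})"
proof -
  have "finite (other_criteria n b w)"
    by (simp add: other_criteria_def)
  then show ?thesis
    by (auto intro: finite_image_set finite_image_set2)
qed

lemma eps_le_max_eps:
  assumes "i \<in> other_criteria n b w"
  shows "eps1 w Ab Aw i \<le> max_eps n b w Ab Aw"
    and "j \<in> other_criteria n b w \<Longrightarrow> eps2 Ab Aw i j \<le> max_eps n b w Ab Aw"
  unfolding max_eps_def using assms by (auto intro!: Max_ge finite_eps)

lemma max_eps_le: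
  assumes "i \<in> other_criteria n b w"
    and "\<And>i. i \<in> other_criteria n b w \<Longrightarrow> eps1 w Ab Aw i \<le> E"
    and "\<And>i j. i \<in> other_criteria n b w \<Longrightarrow> j \<in> other_criteria n b w \<Longrightarrow> eps2 Ab Aw i j \<le> E"
  shows "max_eps n b w Ab Aw \<le> E"
  unfolding max_eps_def using assms by (subst Max_le_iff[OF finite_eps]) auto

lemma pcs_pos:
  assumes "is_pcs n b w Ab Aw" "i \<in> other_criteria n b w"
  shows "0 < Ab i" "0 < Aw i" "0 < Ab w"
  using assms unfolding is_pcs_def by fastforce+

text \<open>
  The value \<open>z\<close> of a feasible solution is a common point of all intervals at tolerance \<open>\<eta>\<close>, so any
  two of them meet.
\<close>

lemma max_eps_le_feasible:
  assumes pcs: "is_pcs n b w Ab Aw" and k: "k \<in> other_criteria n b w"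
    and feas: "feasible n b w Ab Aw x y z \<eta>"
  shows "max_eps n b w Ab Aw \<le> \<eta>"
proof (rule max_eps_le[OF k])
  note pos = pcs_pos[OF pcs]
  have z: "\<bar>z - Ab w\<bar> \<le> \<eta>"
    using feas by (simp add: feasible_def)
  then have \<eta>: "0 \<le> \<eta>"
    by linarith
  have lo: "least_product (Ab i) (Aw i) \<eta> \<le> z" and hi: "z \<le> (Ab i + \<eta>) * (Aw i + \<eta>)"
    if "i \<in> other_criteria n b w" for i
    using feas that product_bounds[of "x i" "y i" "Ab i" \<eta> "Aw i"]
    by (auto simp: feasible_def)
  show "eps1 w Ab Aw i \<le> \<eta>" if i: "i \<in> other_criteria n b w" for i
  proof -
    have "Ab w - \<eta> \<le> z" "z \<le> Ab w + \<eta>"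
      using z by linarith+
    then show ?thesis
      using lo[OF i] hi[OF i] pos[OF i] \<eta> by (subst eps1_le_iff) auto
  qed
  show "eps2 Ab Aw i j \<le> \<eta>"
    if "i \<in> other_criteria n b w" "j \<in> other_criteria n b w" for i j
    using lo[OF that(1)] hi[OF that(1)] lo[OF that(2)] hi[OF that(2)]
      pos[OF that(1)] pos[OF that(2)] \<eta>
    by (subst eps2_le_iff) auto
qed

lemma max_eps_nonneg:
  assumes "i \<in> other_criteria n b w"
  shows "0 \<le> max_eps n b w Ab Aw"
  using eps_le_max_eps(1)[OF assms, of Ab Aw] by (simp add: eps1_def)

lemma intervals_meet_at_max_eps:
  assumes pcs: "is_pcs n b w Ab Aw" and i: "i \<in> other_criteria n b w"
    and E: "E = max_eps n b w Ab Aw"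
  shows "Ab w - E \<le> (Ab i + E) * (Aw i + E)"
    and "least_product (Ab i) (Aw i) E \<le> Ab w + E"
    and "j \<in> other_criteria n b w \<Longrightarrow>
      least_product (Ab i) (Aw i) E \<le> (Ab j + E) * (Aw j + E)"
proof -
  note pos = pcs_pos[OF pcs]
  have E0: "0 \<le> E"
    unfolding E by (rule max_eps_nonneg[OF i])
  have "eps1 w Ab Aw i \<le> E"
    unfolding E by (rule eps_le_max_eps(1)[OF i])
  then show "Ab w - E \<le> (Ab i + E) * (Aw i + E)"
    and "least_product (Ab i) (Aw i) E \<le> Ab w + E"
    using pos[OF i] E0 by (simp_all add: eps1_le_iff)
  show "least_product (Ab i) (Aw i) E \<le> (Ab j + E) * (Aw j + E)"
    if j: "j \<in> other_criteria n b w"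
  proof -
    have "eps2 Ab Aw i j \<le> E"
      unfolding E by (rule eps_le_max_eps(2)[OF i j])
    then show ?thesis
      using pos[OF i] pos[OF j] E0 by (simp add: eps2_le_iff)
  qed
qed

text \<open>
  A point common to all intervals at tolerance \<open>max_eps\<close> yields a feasible solution whose
  objective value reaches the lower bound of \<open>max_eps_le_feasible\<close>.
\<close>

lemma common_point_optimal:
  assumes bw: "b \<noteq> w" and pcs: "is_pcs n b w Ab Aw" and k: "k \<in> other_criteria n b w"
    and E: "E = max_eps n b w Ab Aw"
    and P: "Ab w - E \<le> P" "P \<le> Ab w + E"
    and lo: "\<And>i. i \<in> other_criteria n b w \<Longrightarrow> least_product (Ab i) (Aw i) E \<le> P"
    and hi: "\<And>i. i \<in> other_criteria n b w \<Longrightarrow> P \<le> (Ab i + E) * (Aw i + E)"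
  shows "optimal_value n b w Ab Aw = E \<and>
    optimally_modified_pcs n b w Ab Aw (modified_best b w Ab Aw P) (modified_worst b w Ab Aw P)"
proof -
  let ?x = "modified_best b w Ab Aw P" and ?y = "modified_worst b w Ab Aw P"
  have E0: "0 \<le> E"
    unfolding E by (rule max_eps_nonneg[OF k])
  have P0: "0 \<le> P"
    using lo[OF k] least_product_nonneg[of "Ab k" "Aw k" E] by linarith
  have "\<bar>?x i - Ab i\<bar> \<le> E \<and> \<bar>?y i - Aw i\<bar> \<le> E \<and> ?x i * ?y i = P \<and> 0 \<le> ?x i \<and> 0 \<le> ?y i"
    if i: "i \<in> other_criteria n b w" for i
  proof -
    have "?x i = alpha Ab Aw i P" "?y i = beta Ab Aw i P"
      using i by (auto simp: other_criteria_def modified_best_def modified_worst_def)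
    then show ?thesis
      using alpha_beta_within[of Ab i Aw E P] pcs_pos[OF pcs i] E0 lo[OF i] hi[OF i] by simp
  qed
  then have feas: "feasible n b w Ab Aw ?x ?y P E"
    using P P0 unfolding feasible_def by (simp add: abs_le_iff)
  have bound: "E \<le> \<eta>" if "feasible n b w Ab Aw x y z \<eta>" for x y z \<eta>
    unfolding E by (rule max_eps_le_feasible[OF pcs k that])
  have opt: "optimal_value n b w Ab Aw = E"
    unfolding optimal_value_def using feas bound by (intro cInf_eq_minimum) auto
  show ?thesis
    using bw feas bound opt
    unfolding optimally_modified_pcs_def optimal_solution_def
    by (auto simp: modified_best_def modified_worst_def)
qed

(* In the last part, eps2 is symmetric in i0 and j0 but the formula for P is not: i0 has to
   be the criterion with the smaller product Ab i0 * Aw i0. With i0 and j0 exchanged (and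
   distinct products) the resulting pair is not feasible. *)
theorem theorem2:
  fixes n b w :: nat and Ab Aw :: "nat \<Rightarrow> real"
  assumes "n \<ge> 3"
    and "b \<in> {1..n}" and "w \<in> {1..n}" and "b \<noteq> w"
    and "is_pcs n b w Ab Aw"
  shows
    "(\<forall>i0\<in>D1 n b w Ab Aw. eps1 w Ab Aw i0 = max_eps n b w Ab Aw \<longrightarrow>
        optimal_value n b w Ab Aw = eps1 w Ab Aw i0 \<and>
        (let P = Ab w - eps1 w Ab Aw i0 in
          optimally_modified_pcs n b w Ab Aw
            (modified_best b w Ab Aw P) (modified_worst b w Ab Aw P))) \<and>
     (\<forall>j0\<in>D2 n b w Ab Aw. eps1 w Ab Aw j0 = max_eps n b w Ab Aw \<longrightarrow>
        optimal_value n b w Ab Aw = eps1 w Ab Aw j0 \<and>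
        (let P = Ab w + eps1 w Ab Aw j0 in
          optimally_modified_pcs n b w Ab Aw
            (modified_best b w Ab Aw P) (modified_worst b w Ab Aw P))) \<and>
     (\<forall>i0\<in>other_criteria n b w. \<forall>j0\<in>other_criteria n b w.
        eps2 Ab Aw i0 j0 = max_eps n b w Ab Aw \<longrightarrow>
        optimal_value n b w Ab Aw = eps2 Ab Aw i0 j0 \<and>
        (Ab i0 * Aw i0 \<le> Ab j0 * Aw j0 \<longrightarrow>
          (let P = (Ab i0 + eps2 Ab Aw i0 j0) * (Aw i0 + eps2 Ab Aw i0 j0) in
            optimally_modified_pcs n b w Ab Aw
              (modified_best b w Ab Aw P) (modified_worst b w Ab Aw P))))"
proof -
  have bw: "b \<noteq> w" and pcs: "is_pcs n b w Ab Aw"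
    using assms by simp_all
  define E where "E = max_eps n b w Ab Aw"
  note pos = pcs_pos[OF pcs] and meet = intervals_meet_at_max_eps[OF pcs _ E_def]
    and optimal = common_point_optimal[OF bw pcs _ E_def]
  have below: "optimal_value n b w Ab Aw = E \<and>
      optimally_modified_pcs n b w Ab Aw
        (modified_best b w Ab Aw (Ab w - E)) (modified_worst b w Ab Aw (Ab w - E))"
    if i0: "i0 \<in> D1 n b w Ab Aw" and eq: "eps1 w Ab Aw i0 = E" for i0
  proof -
    have i: "i0 \<in> other_criteria n b w" and less: "Ab i0 * Aw i0 < Ab w"
      using i0 by (simp_all add: D1_def)
    have touch: "Ab w - E = (Ab i0 + E) * (Aw i0 + E)"
      using eps1_touch_below[of Ab i0 Aw w] pos[OF i] less eq by simp
    show ?thesis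
    proof (rule optimal[OF i])
      show "Ab w - E \<le> Ab w + E"
        using max_eps_nonneg[OF i, of Ab Aw] by (simp add: E_def)
      show "least_product (Ab k) (Aw k) E \<le> Ab w - E" if "k \<in> other_criteria n b w" for k
        unfolding touch using meet(3)[OF that i] .
      show "Ab w - E \<le> (Ab k + E) * (Aw k + E)" if "k \<in> other_criteria n b w" for k
        using meet(1)[OF that] .
    qed simp
  qed
  have above: "optimal_value n b w Ab Aw = E \<and>
      optimally_modified_pcs n b w Ab Aw
        (modified_best b w Ab Aw (Ab w + E)) (modified_worst b w Ab Aw (Ab w + E))"
    if j0: "j0 \<in> D2 n b w Ab Aw" and eq: "eps1 w Ab Aw j0 = E" for j0
  proof -
    have j: "j0 \<in> other_criteria n b w" and less: "Ab w < Ab j0 * Aw j0"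
      using j0 by (simp_all add: D2_def)
    have touch: "Ab w + E = least_product (Ab j0) (Aw j0) E"
      using eps1_touch_above[of Ab j0 Aw w] pos[OF j] less eq by simp
    show ?thesis
    proof (rule optimal[OF j])
      show "Ab w - E \<le> Ab w + E"
        using max_eps_nonneg[OF j, of Ab Aw] by (simp add: E_def)
      show "least_product (Ab k) (Aw k) E \<le> Ab w + E" if "k \<in> other_criteria n b w" for k
        using meet(2)[OF that] .
      show "Ab w + E \<le> (Ab k + E) * (Aw k + E)" if "k \<in> other_criteria n b w" for k
        unfolding touch using meet(3)[OF j that] .
    qed simp
  qed
  have between: "optimal_value n b w Ab Aw = E \<and>
      optimally_modified_pcs n b w Ab Aw
        (modified_best b w Ab Aw ((Ab i0 + E) * (Aw i0 + E)))
        (modified_worst b w Ab Aw ((Ab i0 + E) * (Aw i0 + E)))"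
    if i: "i0 \<in> other_criteria n b w" and j: "j0 \<in> other_criteria n b w"
      and eq: "eps2 Ab Aw i0 j0 = E" and le: "Ab i0 * Aw i0 \<le> Ab j0 * Aw j0" for i0 j0
  proof -
    have touch: "(Ab i0 + E) * (Aw i0 + E) = least_product (Ab j0) (Aw j0) E"
      using eps2_touch[of Ab i0 Aw j0] pos[OF i] pos[OF j] le eq by simp
    show ?thesis
    proof (rule optimal[OF i])
      show "Ab w - E \<le> (Ab i0 + E) * (Aw i0 + E)"
        using meet(1)[OF i] .
      show "(Ab i0 + E) * (Aw i0 + E) \<le> Ab w + E"
        unfolding touch using meet(2)[OF j] .
      show "least_product (Ab k) (Aw k) E \<le> (Ab i0 + E) * (Aw i0 + E)"
        if "k \<in> other_criteria n b w" for k
        using meet(3)[OF that i] .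
      show "(Ab i0 + E) * (Aw i0 + E) \<le> (Ab k + E) * (Aw k + E)"
        if "k \<in> other_criteria n b w" for k
        unfolding touch using meet(3)[OF j that] .
    qed
  qed
  \<comment> \<open>The optimal value in the last part is claimed in either order of the two products.\<close>
  have between_value: "optimal_value n b w Ab Aw = E"
    if i: "i0 \<in> other_criteria n b w" and j: "j0 \<in> other_criteria n b w"
      and eq: "eps2 Ab Aw i0 j0 = E" for i0 j0
  proof -
    have "eps2 Ab Aw j0 i0 = eps2 Ab Aw i0 j0"
      by (simp add: eps2_def abs_minus_commute abs_divide add_ac)
    then show ?thesis
      using between[OF i j] between[OF j i] eq by (metis linear)
  qed
  show ?thesis
    unfolding Let_def E_def[symmetric]
    using below above between between_value by simp
qed

end
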